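(* Every co-analytic ideal on $\omega$ satisfies the Category Dichotomy.
   Context: An ideal on $\omega$ is a family of subsets of $\omega$ closed under subsets and finite unions, containing $\emptyset$ and not containing $\omega$; it is co-analytic if it is a co-analytic subset of $\mathcal P(\omega)\cong 2^\omega$. $\mathcal I^+=\mathcal P(\omega)\setminus\mathcal I$, $\mathcal I\restriction X=\mathcal I\cap\mathcal P(X)$. For ideals $\mathcal I$ on $X$ and $\mathcal J$ on $Y$, $\mathcal J\le_{\mathsf K}\mathcal I$ if there is $f:X\to Y$ with $f^{-1}(A)\in\mathcal I$ for all $A\in\mathcal J$. $\mathcal{ED}$ is the ideal on $\omega\times\omega$ generated by the columns $\{n\}\times\omega$ and the graphs of functions $\omega\to\omega$; $\mathsf{nwd}$ is the ideal of nowhere dense subsets of $\mathbb Q$. $\mathcal I$ satisfies the Category Dichotomy if $\mathcal I\le_{\mathsf K}\mathsf{nwd}$ or there is $X\in\mathcal I^+$ with $\mathcal{ED}\le_{\mathsf K}\mathcal I\restriction X$. *)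

theory Defs
  imports "HOL-Analysis.Analysis"
begin

definition ideal_on :: "'a set set \<Rightarrow> 'a set \<Rightarrow> bool" where
  "ideal_on I X \<longleftrightarrow> I \<subseteq> Pow X \<and> {} \<in> I \<and> X \<notin> I
     \<and> (\<forall>A\<in>I. \<forall>B. B \<subseteq> A \<longrightarrow> B \<in> I)
     \<and> (\<forall>A\<in>I. \<forall>B\<in>I. A \<union> B \<in> I)"

definition cantor_space :: "(nat \<Rightarrow> bool) topology" where
  "cantor_space = product_topology (\<lambda>_. discrete_topology UNIV) UNIV"

definition baire_space :: "(nat \<Rightarrow> nat) topology" where
  "baire_space = product_topology (\<lambda>_. discrete_topology UNIV) UNIV"

definition analytic_set :: "(nat \<Rightarrow> bool) set \<Rightarrow> bool" where
  "analytic_set S \<longleftrightarrow> S = {} \<or> (\<exists>f. continuous_map baire_space cantor_space f \<and> f ` UNIV = S)"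

definition coanalytic_set :: "(nat \<Rightarrow> bool) set \<Rightarrow> bool" where
  "coanalytic_set S \<longleftrightarrow> analytic_set (- S)"

definition coanalytic :: "nat set set \<Rightarrow> bool" where
  "coanalytic I \<longleftrightarrow> coanalytic_set ((\<lambda>A n. n \<in> A) ` I)"

definition katetov_le :: "'b set set \<Rightarrow> 'b set \<Rightarrow> 'a set set \<Rightarrow> 'a set \<Rightarrow> bool" where
  "katetov_le J Y I X \<longleftrightarrow> (\<exists>f. f \<in> X \<rightarrow> Y \<and> (\<forall>A\<in>J. {x\<in>X. f x \<in> A} \<in> I))"

definition ED :: "(nat \<times> nat) set set" where
  "ED = {A. \<exists>F G. finite F \<and> finite G \<and>
            A \<subseteq> (\<Union>n\<in>F. {n} \<times> UNIV) \<union> (\<Union>g\<in>G. {(n, g n) | n. True})}"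

definition nwd :: "real set set" where
  "nwd = {A. A \<subseteq> \<rat> \<and>
     (top_of_set \<rat>) interior_of ((top_of_set \<rat>) closure_of A) = {}}"

definition category_dichotomy :: "nat set set \<Rightarrow> bool" where
  "category_dichotomy I \<longleftrightarrow>
     katetov_le I UNIV nwd \<rat> \<or>
     (\<exists>X. X \<notin> I \<and> katetov_le ED UNIV (I \<inter> Pow X) X)"

end

theory Submission
  imports Defs
begin

text \<open>If no restriction of the ideal \<open>I\<close> to a positive set is above \<open>ED\<close>, then every partition of a
  positive set into sets of \<open>I\<close> has a positive selector, and hence every positive \<open>X\<close> contains a positive
  set that diagonalizes a given assignment of members of \<open>I\<close> to finite sets. The key step is an
  unfolded game: the positive sets are the values of a continuous \<open>f\<close> on Baire space, and one player
  enumerates increasingly a subset of \<open>X\<close>, avoiding the members of \<open>I\<close> that the opponent plays, while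
  also revealing, at a pace of his choice, a \<open>y\<close> with \<open>f y\<close> equal to that set. Selectivity shows that he
  can always force the next digit of \<open>y\<close> to be revealed (this replaces determinacy). The positive sets
  of possible moves in these forcings form a countable family, and a member of \<open>I\<close> that meets all of
  them would contain a whole run, that is, a positive set. So below every positive set there are
  countably many positive sets such that each member of \<open>I\<close> is disjoint from one of them. Iterating
  this along the dyadic intervals gives a map from the rationals witnessing that \<open>I\<close> is below \<open>nwd\<close>.\<close>

section \<open>Ideals containing the finite sets: selectors and diagonalization\<close>

locale nat_ideal =
  fixes I :: "nat set set"
  assumes ideal: "ideal_on I UNIV"
    and finite_mem: "finite A \<Longrightarrow> A \<in> I"
begin

lemma mono_mem: "A \<in> I \<Longrightarrow> B \<subseteq> A \<Longrightarrow> B \<in> I"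
  using ideal unfolding ideal_on_def by blast

lemma Un_mem: "A \<in> I \<Longrightarrow> B \<in> I \<Longrightarrow> A \<union> B \<in> I"
  using ideal unfolding ideal_on_def by blast

lemma UNIV_notin: "UNIV \<notin> I"
  using ideal unfolding ideal_on_def by blast

lemma UN_mem: "finite F \<Longrightarrow> (\<And>x. x \<in> F \<Longrightarrow> A x \<in> I) \<Longrightarrow> (\<Union>x\<in>F. A x) \<in> I"
  by (induction F rule: finite_induct) (auto intro: Un_mem finite_mem)

lemma Diff_notin: "X \<notin> I \<Longrightarrow> A \<in> I \<Longrightarrow> X - A \<notin> I"
  using Un_mem[of "X - A" A] mono_mem[of "X - A \<union> A" X] by blast

end

definition selective :: "nat set set \<Rightarrow> bool" where
  "selective I \<longleftrightarrow> (\<forall>X c. X \<notin> I \<longrightarrow> (\<forall>k. {x\<in>X. c x = k} \<in> I) \<longrightarrow>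
     (\<exists>Z\<subseteq>X. Z \<notin> I \<and> inj_on (c :: nat \<Rightarrow> nat) Z))"

text \<open>Since x \<mapsto> (c x, x) is not a reduction, some member of \<open>ED\<close> has
  positive preimage. Columns pull back to pieces of the partition, which lie in \<open>I\<close>, so
  the graph of some \<open>g\<close> pulls back to a positive set. On it \<open>c x\<close>
  determines x = g (c x).\<close>

lemma (in nat_ideal) selective_if_not_ED_le:
  assumes "\<And>X. X \<notin> I \<Longrightarrow> \<not> katetov_le ED UNIV (I \<inter> Pow X) X"
  shows "selective I"
  unfolding selective_def
proof (intro allI impI)
  fix X :: "nat set" and c :: "nat \<Rightarrow> nat"
  assume X: "X \<notin> I" and c: "\<forall>k. {x\<in>X. c x = k} \<in> I"
  have "\<exists>A\<in>ED. {x\<in>X. (c x, x) \<in> A} \<notin> I"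
    using assms[OF X] unfolding katetov_le_def
    by (auto dest!: spec[of _ "\<lambda>x. (c x, x)"])
  then obtain A where A: "A \<in> ED" "{x\<in>X. (c x, x) \<in> A} \<notin> I" by blast
  from A(1) obtain F G where FG: "finite F" "finite G"
    "A \<subseteq> (\<Union>n\<in>F. {n} \<times> UNIV) \<union> (\<Union>g\<in>G. {(n, g n) | n. True})"
    unfolding ED_def by blast
  have "{x\<in>X. (c x, x) \<in> A} \<subseteq> (\<Union>n\<in>F. {x\<in>X. c x = n}) \<union> (\<Union>g\<in>G. {x\<in>X. g (c x) = x})"
  proof
    fix x assume x: "x \<in> {x\<in>X. (c x, x) \<in> A}"
    then have "(c x, x) \<in> (\<Union>n\<in>F. {n} \<times> UNIV) \<union> (\<Union>g\<in>G. {(n, g n) | n. True})"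
      using FG(3) by blast
    then show "x \<in> (\<Union>n\<in>F. {x\<in>X. c x = n}) \<union> (\<Union>g\<in>G. {x\<in>X. g (c x) = x})"
      using x by auto metis
  qed
  then have "(\<Union>n\<in>F. {x\<in>X. c x = n}) \<union> (\<Union>g\<in>G. {x\<in>X. g (c x) = x}) \<notin> I"
    using A(2) mono_mem by blast
  moreover have "(\<Union>n\<in>F. {x\<in>X. c x = n}) \<in> I"
    using c FG(1) by (intro UN_mem) auto
  ultimately obtain g where "{x\<in>X. g (c x) = x} \<notin> I"
    using Un_mem UN_mem[OF FG(2), of "\<lambda>g. {x\<in>X. g (c x) = x}"] by blast
  moreover have "inj_on c {x\<in>X. g (c x) = x}"
    by (rule inj_on_inverseI[of _ g]) auto
  ultimately show "\<exists>Z\<subseteq>X. Z \<notin> I \<and> inj_on c Z"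
    by (intro exI[of _ "{x\<in>X. g (c x) = x}"]) auto
qed

text \<open>Two selectors in a row. The first makes \<open>Y\<close> meet each \<open>D k\<close> in
  a finite set. The second takes at most one point from each interval [a j, a (Suc j)), and keeping
  one parity leaves a whole interval of slack between chosen points. So each chosen point lies
  beyond all of \<open>Y\<close> that the earlier ones can forbid.\<close>

lemma (in nat_ideal) selective_diagonal:
  assumes sel: "selective I" and X: "X \<notin> I" and A: "\<And>G. finite G \<Longrightarrow> A G \<in> I"
  obtains Z where "Z \<subseteq> X" "Z \<notin> I" "\<And>n. n \<in> Z \<Longrightarrow> n \<notin> A (Z \<inter> {..<n})"
proof -
  \<comment> \<open>Everything that sets bounded by \<open>k\<close> can forbid;
    \<open>{..k}\<close> puts every \<open>x\<close> into some \<open>D k\<close>, so the least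
    index \<open>c x\<close> exists.\<close>
  define D where "D k = {..k} \<union> (\<Union>G\<in>Pow {..k}. A G)" for k
  have D_mem: "D k \<in> I" for k
    unfolding D_def by (intro Un_mem UN_mem A finite_mem) (auto intro: finite_subset)
  define c where "c x = (LEAST k. x \<in> D k)" for x
  have c_mem: "x \<in> D (c x)" for x
    unfolding c_def by (rule LeastI[of _ x]) (auto simp: D_def)
  \<comment> \<open>Removing \<open>A {}\<close> beforehand settles the least point of
    \<open>Z\<close>, which has no predecessor.\<close>
  have "{x \<in> X - A {}. c x = k} \<in> I" for k
    by (rule mono_mem[OF D_mem[of k]]) (use c_mem in auto)
  then obtain Y where Y: "Y \<subseteq> X - A {}" "Y \<notin> I" "inj_on c Y"
    using sel Diff_notin[OF X A[of "{}"]] unfolding selective_def by (metis finite.emptyI)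
  have fin: "finite (Y \<inter> D k)" for k
  proof -
    have "c ` (Y \<inter> D k) \<subseteq> {..k}"
      unfolding c_def by (auto intro: Least_le)
    moreover have "inj_on c (Y \<inter> D k)"
      using Y(3) by (rule inj_on_subset) auto
    ultimately show ?thesis
      by (meson finite_atMost finite_imageD finite_subset)
  qed
  define g where "g k = Suc (Max (insert k (Y \<inter> D k)))" for k
  have g_gt: "k < g k" for k
    unfolding g_def using fin[of k] by (simp add: less_Suc_eq_le)
  have g_D: "x < g k" if "x \<in> Y" "x \<in> D k" for x k
    unfolding g_def using fin[of k] that by (simp add: less_Suc_eq_le)
  define a where "a j = (g ^^ j) 0" for j
  have a_Suc: "a (Suc j) = g (a j)" for j by (simp add: a_def)
  have "strict_mono a"
    using g_gt by (simp add: strict_mono_Suc_iff a_Suc)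
  then have a_mono: "a i \<le> a j" if "i \<le> j" for i j
    using that by (simp add: strict_mono_less_eq)
  define e where "e x = (LEAST j. x < a (Suc j))" for x
  have e_less: "x < a (Suc (e x))" for x
    unfolding e_def
    by (rule LeastI[of _ x]) (use strict_mono_imp_increasing[OF \<open>strict_mono a\<close>, of "Suc x"] in auto)
  have e_le: "a (e x) \<le> x" if "e x \<noteq> 0" for x
    using not_less_Least[of "e x - 1" "\<lambda>j. x < a (Suc j)"] that unfolding e_def[symmetric]
    by simp
  have e_mono: "e x \<le> e y" if "x \<le> y" for x y
    using Least_le[of "\<lambda>j. x < a (Suc j)" "e y"] e_less[of y] that unfolding e_def[symmetric]
    by simp
  have "{x \<in> Y. e x = k} \<in> I" for k
    by (rule finite_mem, rule finite_subset[of _ "{..<a (Suc k)}"]) (use e_less in auto)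
  then obtain Z0 where Z0: "Z0 \<subseteq> Y" "Z0 \<notin> I" "inj_on e Z0"
    using sel Y(2) unfolding selective_def by metis
  obtain b where b: "{x\<in>Z0. even (e x) = b} \<notin> I"
  proof -
    have "Z0 = {x\<in>Z0. even (e x) = True} \<union> {x\<in>Z0. even (e x) = False}" by auto
    then show ?thesis
      using that[of True] that[of False] Z0(2) Un_mem by metis
  qed
  define Z where "Z = {x\<in>Z0. even (e x) = b}"
  have ZY: "Z \<subseteq> Y" using Z0(1) by (auto simp: Z_def)
  show ?thesis
  proof (rule that[of Z])
    show "Z \<subseteq> X" using ZY Y(1) by auto
    show "Z \<notin> I" using b by (simp add: Z_def)
    fix n assume n: "n \<in> Z"
    \<comment> \<open>Distinct interval indices of equal parity differ by at least 2.\<close>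
    have gap: "m < a (e n - 1) \<and> e n \<noteq> 0" if "m \<in> Z" "m < n" for m
    proof -
      have "e m \<noteq> e n"
        using that n Z0(3) by (auto simp: Z_def inj_on_def)
      moreover have "even (e m) = even (e n)"
        using that n by (auto simp: Z_def)
      ultimately have "e m + 2 \<le> e n"
        using e_mono[of m n] that(2) by (auto elim!: evenE oddE)
      then have "a (Suc (e m)) \<le> a (e n - 1)"
        by (intro a_mono) auto
      with e_less[of m] \<open>e m + 2 \<le> e n\<close> show ?thesis by auto
    qed
    show "n \<notin> A (Z \<inter> {..<n})"
    proof (cases "Z \<inter> {..<n} = {}")
      case True
      then show ?thesis using n ZY Y(1) by auto
    next
      case False
      then have en: "e n \<noteq> 0" using gap by auto
      have "Z \<inter> {..<n} \<in> Pow {..a (e n - 1)}"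
        using gap by (auto simp: less_imp_le)
      then have sub: "A (Z \<inter> {..<n}) \<subseteq> D (a (e n - 1))"
        unfolding D_def by blast
      have "g (a (e n - 1)) \<le> n"
        using e_le[OF en] en a_Suc[of "e n - 1"] by simp
      then show ?thesis
        using g_D[of n "a (e n - 1)"] n ZY sub by (meson leD subsetD)
    qed
  qed
qed

section \<open>The unfolded game: large positions and forcing the next digit\<close>

definition initial_seg :: "nat set \<Rightarrow> nat set \<Rightarrow> bool" where
  "initial_seg F Z \<longleftrightarrow> finite F \<and> F \<subseteq> Z \<and> (\<forall>m\<in>F. \<forall>n\<in>Z. n < m \<longrightarrow> n \<in> F)"

definition extends :: "(nat \<Rightarrow> nat) \<Rightarrow> nat list \<Rightarrow> bool" where
  "extends y w \<longleftrightarrow> (\<forall>i<length w. y i = w ! i)"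

lemma initial_seg_lessThan: "initial_seg (Z \<inter> {..<n}) Z"
  by (auto simp: initial_seg_def)

lemma extends_Nil [simp]: "extends y []"
  by (simp add: extends_def)

lemma extends_snoc: "extends y (w @ [d]) \<longleftrightarrow> extends y w \<and> y (length w) = d"
  by (auto simp: extends_def nth_append less_Suc_eq)

text \<open>Here \<open>f\<close> codes the positive sets by points of Baire space, and
  \<open>cont\<close> is its continuity: finitely many digits of the code decide whether
  \<open>n\<close> belongs to the set.\<close>

locale selective_coanalytic = nat_ideal +
  fixes f :: "(nat \<Rightarrow> nat) \<Rightarrow> nat set" and X :: "nat set"
  assumes cont: "\<exists>k. \<forall>y'. (\<forall>i<k. y' i = y i) \<longrightarrow> (n \<in> f y' \<longleftrightarrow> n \<in> f y)"
    and range_f: "range f = - I"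
    and selective: "selective I"
    and X_notin: "X \<notin> I"
begin

text \<open>In a position \<open>(F, w)\<close> of the game, \<open>F\<close> is the set of points enumerated so far and \<open>w\<close> the part of
  the witness revealed so far. A position is large if the positive sets compatible with it cannot be
  blocked by a single map from finite sets to \<open>I\<close>.\<close>

definition large :: "nat set \<Rightarrow> nat list \<Rightarrow> bool" where
  "large F w \<longleftrightarrow> finite F \<and> \<not> (\<exists>A. (\<forall>G. finite G \<longrightarrow> A G \<in> I) \<and>
     (\<forall>y. extends y w \<and> f y \<subseteq> X \<and> initial_seg F (f y) \<longrightarrow>
        (\<exists>n\<in>f y - F. n \<in> A (f y \<inter> {..<n}))))"

text \<open>From the position the next digit can be forced in a well-founded way. A digit may be revealed
  only when \<open>F\<close> has enough elements: this leaves finitely many digits to take care of at each stage,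
  and makes the set enumerated in an infinite run infinite.\<close>

inductive reach :: "nat set \<Rightarrow> nat list \<Rightarrow> bool" where
  witness: "large F (w @ [d]) \<Longrightarrow> d \<le> card F \<Longrightarrow> length w < card F \<Longrightarrow> reach F w"
| point: "S \<notin> I \<Longrightarrow> S \<subseteq> X \<Longrightarrow> (\<And>z. z \<in> S \<Longrightarrow> \<forall>m\<in>F. m < z) \<Longrightarrow>
    (\<And>z. z \<in> S \<Longrightarrow> reach (insert z F) w) \<Longrightarrow> reach F w"

lemma f_notin: "f y \<notin> I"
  using range_f by blast

lemma large_obtains:
  assumes "large F w"
  obtains y where "extends y w" "f y \<subseteq> X" "initial_seg F (f y)"
proof -
  have "\<not> (\<forall>y. extends y w \<and> f y \<subseteq> X \<and> initial_seg F (f y) \<longrightarrow>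
      (\<exists>n\<in>f y - F. n \<in> {}))"
    using assms finite_mem[of "{}"] unfolding large_def
    by (auto dest!: spec[of _ "\<lambda>_. {}"])
  then show ?thesis using that by blast
qed

text \<open>Any candidate blocking map is diagonalized by a positive subset of \<open>X\<close>, and
  this subset has a code.\<close>

lemma large_Nil: "large {} []"
  unfolding large_def
proof (intro conjI notI)
  assume "\<exists>A. (\<forall>G. finite G \<longrightarrow> A G \<in> I) \<and>
     (\<forall>y. extends y [] \<and> f y \<subseteq> X \<and> initial_seg {} (f y) \<longrightarrow>
        (\<exists>n\<in>f y - {}. n \<in> A (f y \<inter> {..<n})))"
  then obtain A where A: "\<And>G. finite G \<Longrightarrow> A G \<in> I"
    and hit: "\<And>y. f y \<subseteq> X \<Longrightarrow> \<exists>n\<in>f y. n \<in> A (f y \<inter> {..<n})"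
    by (auto simp: initial_seg_def)
  obtain Z where Z: "Z \<subseteq> X" "Z \<notin> I" "\<And>n. n \<in> Z \<Longrightarrow> n \<notin> A (Z \<inter> {..<n})"
    using selective_diagonal[of X A, OF selective X_notin A] by metis
  have "Z \<in> range f" using Z(2) range_f by simp
  then obtain y where y: "Z = f y" by blast
  then show False using hit[of y] Z(1,3) by blast
qed simp

text \<open>If \<open>reach\<close> fails, no admissible digit at a stage outside
  \<open>reach\<close> leads to a large position, so each has a blocking map. Merged with the sets
  of moves that enter \<open>reach\<close>, these maps yield one map blocking \<open>(F, w)\<close>
  itself.\<close>

lemma large_imp_reach:
  assumes "large F w"
  shows "reach F w"
proof (rule ccontr)
  assume nreach: "\<not> reach F w"
  have finF: "finite F" using assms by (simp add: large_def)
  have "\<exists>B. (\<forall>H. finite H \<longrightarrow> B H \<in> I) \<and> (finite G \<and> \<not> reach G w \<and> d \<le> card G \<and> length w < card G \<longrightarrow>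
      (\<forall>y. extends y (w @ [d]) \<and> f y \<subseteq> X \<and> initial_seg G (f y) \<longrightarrow>
        (\<exists>n\<in>f y - G. n \<in> B (f y \<inter> {..<n}))))" for G d
  proof (cases "finite G \<and> \<not> reach G w \<and> d \<le> card G \<and> length w < card G")
    case True
    then have "\<not> large G (w @ [d])" using witness by blast
    with True show ?thesis unfolding large_def by blast
  next
    case False
    then show ?thesis by (intro exI[of _ "\<lambda>_. {}"]) (auto intro: finite_mem)
  qed
  then obtain B where B_mem: "\<And>G d H. finite H \<Longrightarrow> B G d H \<in> I"
    and B: "\<And>G d y. finite G \<Longrightarrow> \<not> reach G w \<Longrightarrow> d \<le> card G \<Longrightarrow> length w < card G \<Longrightarrow>
      extends y (w @ [d]) \<Longrightarrow> f y \<subseteq> X \<Longrightarrow> initial_seg G (f y) \<Longrightarrow>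
      \<exists>n\<in>f y - G. n \<in> B G d (f y \<inter> {..<n})"
    by metis
  define S where "S H = {z\<in>X. (\<forall>m\<in>H. m < z) \<and> reach (insert z H) w}" for H
  have S_mem: "S H \<in> I" if "\<not> reach H w" for H
    using that point[of "S H" H w] unfolding S_def by blast
  \<comment> \<open>Forbids moves into \<open>reach\<close>, and applies the blocking maps of all
    stages \<open>G\<close> contained in \<open>H\<close>. The bound on \<open>d\<close> keeps the
    union finite, hence in \<open>I\<close>.\<close>
  define A where "A H = (if reach H w then {} else S H) \<union>
    (\<Union>G\<in>Pow H. \<Union>d\<in>{..card G}. B G d H)" for H
  have "A H \<in> I" if "finite H" for H
    unfolding A_def using that
    by (intro Un_mem UN_mem B_mem) (auto intro: S_mem finite_mem)
  moreover have "\<exists>n\<in>f y - F. n \<in> A (f y \<inter> {..<n})"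
    if y: "extends y w" "f y \<subseteq> X" and init: "initial_seg F (f y)" for y
  proof (rule ccontr)
    assume "\<not> ?thesis"
    then have avoid: "\<And>n. n \<in> f y \<Longrightarrow> n \<notin> F \<Longrightarrow> n \<notin> A (f y \<inter> {..<n})" by blast
    \<comment> \<open>A set avoiding \<open>A\<close> never enters \<open>reach\<close> while it is
      enumerated from \<open>F\<close> upwards.\<close>
    have stay: "\<not> reach (F \<union> f y \<inter> {..<n}) w" for n
    proof (induction n)
      case 0
      then show ?case using nreach by simp
    next
      case (Suc n)
      show ?case
      proof (cases "n \<in> f y - F")
        case True
        then have less: "\<forall>m\<in>F. m < n"
          using init unfolding initial_seg_def by (metis DiffE linorder_neqE_nat)
        then have eq: "F \<union> f y \<inter> {..<n} = f y \<inter> {..<n}"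
          using init by (auto simp: initial_seg_def)
        have "\<not> reach (f y \<inter> {..<n}) w"
          using Suc unfolding eq .
        then have "n \<notin> S (f y \<inter> {..<n})"
          using avoid[of n] True unfolding A_def by simp
        then have "\<not> reach (insert n (f y \<inter> {..<n})) w"
          using True y(2) unfolding S_def by auto
        moreover have "F \<union> f y \<inter> {..<Suc n} = insert n (F \<union> f y \<inter> {..<n})"
          using True by (auto simp: less_Suc_eq)
        ultimately show ?thesis
          unfolding eq by simp
      next
        case False
        then have "F \<union> f y \<inter> {..<Suc n} = F \<union> f y \<inter> {..<n}"
          by (auto simp: less_Suc_eq)
        then show ?thesis using Suc by simp
      qed
    qed
    define d where "d = y (length w)"
    have "infinite (f y)" using f_notin finite_mem by blast
    \<comment> \<open>Enough points to permit revealing the actual next digit \<open>d\<close>: both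
      side conditions of \<open>witness\<close> hold once \<open>Q\<close> is enumerated.\<close>
    then obtain Q where Q: "Q \<subseteq> f y" "finite Q" "card Q = Suc (d + length w)"
      by (meson infinite_arbitrarily_large)
    obtain n where n: "F \<union> Q \<subseteq> {..<n}"
      using finF Q(2) by (metis finite_UnI finite_nat_set_iff_bounded lessThan_iff subsetI)
    define G where "G = f y \<inter> {..<n}"
    have FG: "F \<subseteq> G" using n init by (auto simp: G_def initial_seg_def)
    have "Suc (d + length w) \<le> card G"
      using card_mono[of G Q] Q n by (auto simp: G_def)
    moreover have "\<not> reach G w"
      using stay[of n] FG by (simp add: G_def Un_absorb1)
    moreover have "extends y (w @ [d])"
      using y(1) by (simp add: extends_snoc d_def)
    ultimately obtain n' where n': "n' \<in> f y - G" "n' \<in> B G d (f y \<inter> {..<n'})"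
      using B[of G d y] y(2) initial_seg_lessThan[of "f y" n] by (auto simp: G_def)
    have "G \<subseteq> f y \<inter> {..<n'}" using n'(1) by (auto simp: G_def)
    moreover have "d \<le> card G" using \<open>Suc (d + length w) \<le> card G\<close> by simp
    ultimately have "n' \<in> A (f y \<inter> {..<n'})"
      unfolding A_def using n'(2) by blast
    then show False using avoid n'(1) FG by blast
  qed
  ultimately show False using assms unfolding large_def by blast
qed

section \<open>Rounds and runs of the game; countable omitting families\<close>

definition step :: "nat set \<Rightarrow> nat set \<times> nat list \<Rightarrow> nat set \<times> nat list \<Rightarrow> bool" where
  "step A p q \<longleftrightarrow> large (fst q) (snd q) \<and> fst p \<subseteq> fst q \<and> fst q \<subseteq> fst p \<union> A \<and>
     (\<forall>m\<in>fst p. \<forall>z\<in>fst q - fst p. m < z) \<and> length (snd p) < card (fst q) \<and>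
     (\<exists>d. snd q = snd p @ [d])"

text \<open>A \<open>step\<close> is a full round: points of \<open>A\<close> are enumerated on top,
  then one digit is revealed. The family collects the sets \<open>S\<close> at the
  \<open>point\<close> nodes of the derivation of \<open>reach\<close>, which branches countably. If
  \<open>A\<close> meets them all, points of \<open>A\<close> lead down to a \<open>witness\<close>
  leaf, completing a round.\<close>

lemma reach_imp_countable_family:
  assumes "reach F w"
  shows "\<exists>\<S>. countable \<S> \<and> (\<forall>S\<in>\<S>. S \<subseteq> X \<and> S \<notin> I) \<and>
    (\<forall>A. (\<forall>S\<in>\<S>. S \<inter> A \<noteq> {}) \<longrightarrow> (\<exists>q. step A (F, w) q))"
  using assms
proof (induction rule: reach.induct)
  case (witness F w d)
  then show ?case
    by (intro exI[of _ "{}"]) (auto simp: step_def)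
next
  case (point S F w)
  then obtain \<S> where \<S>: "\<And>z. z \<in> S \<Longrightarrow> countable (\<S> z)"
    "\<And>z T. z \<in> S \<Longrightarrow> T \<in> \<S> z \<Longrightarrow> T \<subseteq> X \<and> T \<notin> I"
    "\<And>z A. z \<in> S \<Longrightarrow> (\<forall>T\<in>\<S> z. T \<inter> A \<noteq> {}) \<Longrightarrow> \<exists>q. step A (insert z F, w) q"
    by metis
  show ?case
  proof (intro exI[of _ "insert S (\<Union>z\<in>S. \<S> z)"] conjI allI impI)
    show "countable (insert S (\<Union>z\<in>S. \<S> z))"
      using \<S>(1) by auto
    show "\<forall>T\<in>insert S (\<Union>z\<in>S. \<S> z). T \<subseteq> X \<and> T \<notin> I"
      using \<S>(2) point by auto
    fix A assume A: "\<forall>T\<in>insert S (\<Union>z\<in>S. \<S> z). T \<inter> A \<noteq> {}"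
    then obtain z where z: "z \<in> S" "z \<in> A" by auto
    with A obtain q where "step A (insert z F, w) q" using \<S>(3)[of z A] by auto
    moreover from this have "\<forall>m\<in>F. \<forall>x\<in>fst q - F. m < x"
      using point(3)[OF z(1)] unfolding step_def by (metis Diff_iff fst_conv insertCI insertE)
    ultimately have "step A (F, w) q"
      using z unfolding step_def by auto
    then show "\<exists>q. step A (F, w) q" by blast
  qed
qed

text \<open>The revealed digits form a code \<open>y\<close>. Each position is large, so it is
  realized by some code extending \<open>w k\<close>; by continuity \<open>f y\<close> is the union
  of the sets \<open>F k\<close>. This union is contained in \<open>A\<close>, yet
  \<open>f y\<close> is positive.\<close>

lemma no_infinite_run:
  assumes A: "A \<in> I" and p0: "p 0 = ({}, [])" and step: "\<And>k. step A (p k) (p (Suc k))"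
  shows False
proof -
  define F where "F k = fst (p k)" for k
  define w where "w k = snd (p k)" for k
  have large_Suc: "large (F (Suc k)) (w (Suc k))"
    and F_Suc: "F k \<subseteq> F (Suc k)" "F (Suc k) \<subseteq> F k \<union> A"
    and end_Suc: "\<forall>m\<in>F k. \<forall>z\<in>F (Suc k) - F k. m < z"
    and card_Suc: "length (w k) < card (F (Suc k))"
    and w_Suc: "\<exists>d. w (Suc k) = w k @ [d]" for k
    using step[of k] unfolding step_def F_def w_def by blast+
  have zero: "F 0 = {}" "w 0 = []" by (simp_all add: F_def w_def p0)
  have large: "large (F k) (w k)" for k
    using large_Nil large_Suc zero by (cases k) auto
  have len: "length (w k) = k" for k
  proof (induction k)
    case (Suc k)
    then show ?case using w_Suc[of k] by auto
  qed (simp add: zero)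
  have F_card: "k \<le> card (F k)" for k
    using card_Suc[of "k - 1"] len[of "k - 1"] by (cases k) auto
  have FA: "F k \<subseteq> A" for k
  proof (induction k)
    case (Suc k)
    then show ?case using F_Suc(2)[of k] by blast
  qed (simp add: zero)
  have F_mono: "F k \<subseteq> F l" if "k \<le> l" for k l
    using F_Suc(1) that by (rule lift_Suc_mono_le)
  have F_end: "n \<in> F k" if "n \<in> F l" "m \<in> F k" "n \<le> m" for n m k l
    using that(1)
  proof (induction l)
    case 0
    then show ?case by (simp add: zero)
  next
    case (Suc l)
    show ?case
    proof (cases "l < k")
      case True
      then show ?thesis using Suc.prems F_mono[of "Suc l" k] by auto
    next
      case False
      then have "m \<in> F l" using F_mono[of k l] that(2) by auto
      then have "n \<in> F l"
        using end_Suc[of l] Suc.prems that(3) by (metis Diff_iff leD)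
      then show ?thesis by (rule Suc.IH)
    qed
  qed
  define y where "y i = w (Suc i) ! i" for i
  have w_nth: "w l ! i = y i" if "i < l" for i l
    using that
  proof (induction l)
    case (Suc l)
    obtain d where "w (Suc l) = w l @ [d]"
      using w_Suc by blast
    then show ?case
      using Suc len[of l] by (cases "i = l") (auto simp: y_def nth_append)
  qed simp
  have "n \<in> f y \<longleftrightarrow> n \<in> (\<Union>k. F k)" for n
  proof -
    obtain k where k: "\<And>y'. (\<forall>i<k. y' i = y i) \<Longrightarrow> n \<in> f y' \<longleftrightarrow> n \<in> f y"
      using cont[where y = y and n = n] by blast
    \<comment> \<open>Late enough that \<open>w l\<close> fixes the digits deciding
      \<open>n\<close>, and that \<open>F l\<close>, having more than \<open>n\<close> elements,
      reaches up to \<open>n\<close>.\<close>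
    define l where "l = max k (Suc (Suc n))"
    obtain m where m: "m \<in> F l" "n \<le> m"
    proof -
      have "\<not> F l \<subseteq> {..<n}"
        using card_mono[of "{..<n}" "F l"] F_card[of l] by (auto simp: l_def)
      then show ?thesis using that by (meson lessThan_iff not_le subsetI)
    qed
    obtain y' where y': "extends y' (w l)" "initial_seg (F l) (f y')"
      using large_obtains[OF large] by blast
    then have "\<forall>i<k. y' i = y i"
      using w_nth len[of l] by (auto simp: extends_def l_def)
    then have "n \<in> f y \<longleftrightarrow> n \<in> f y'" using k by blast
    also have "\<dots> \<longleftrightarrow> n \<in> F l"
      using y'(2) m unfolding initial_seg_def by (metis le_neq_implies_less subsetD)
    also have "\<dots> \<longleftrightarrow> n \<in> (\<Union>k. F k)"
      using F_end m by blast
    finally show ?thesis .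
  qed
  then have "f y \<subseteq> A" using FA by blast
  then show False using f_notin mono_mem A by blast
qed

text \<open>There are countably many large positions, so their families can be united. A member of
  \<open>I\<close> meeting every set of the union would allow a round at each large position, ending
  in a large one, hence an infinite run.\<close>

lemma countable_omitting_family:
  "\<exists>\<S>. countable \<S> \<and> (\<forall>S\<in>\<S>. S \<subseteq> X \<and> S \<notin> I) \<and> (\<forall>A\<in>I. \<exists>S\<in>\<S>. S \<inter> A = {})"
proof -
  define P where "P = {p. large (fst p) (snd p)}"
  have "P \<subseteq> {F. finite F} \<times> UNIV" by (auto simp: P_def large_def)
  moreover have "countable ({F :: nat set. finite F} \<times> (UNIV :: nat list set))"
    by (intro countable_SIGMA countable_Collect_finite) auto
  ultimately have cP: "countable P" by (rule countable_subset)
  have "\<exists>\<S>. countable \<S> \<and> (\<forall>S\<in>\<S>. S \<subseteq> X \<and> S \<notin> I) \<and>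
    (\<forall>A. (\<forall>S\<in>\<S>. S \<inter> A \<noteq> {}) \<longrightarrow> (\<exists>q. step A p q))" if "p \<in> P" for p
    using reach_imp_countable_family[OF large_imp_reach, of "fst p" "snd p"] that
    by (simp add: P_def)
  then obtain \<S> where \<S>: "\<And>p. p \<in> P \<Longrightarrow> countable (\<S> p)"
    "\<And>p S. p \<in> P \<Longrightarrow> S \<in> \<S> p \<Longrightarrow> S \<subseteq> X \<and> S \<notin> I"
    "\<And>p A. p \<in> P \<Longrightarrow> (\<forall>S\<in>\<S> p. S \<inter> A \<noteq> {}) \<Longrightarrow> \<exists>q. step A p q"
    by metis
  have "\<exists>S\<in>(\<Union>p\<in>P. \<S> p). S \<inter> A = {}" if "A \<in> I" for A
  proof (rule ccontr)
    assume "\<not> ?thesis"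
    then have "\<forall>S\<in>\<S> p. S \<inter> A \<noteq> {}" if "p \<in> P" for p
      using that by blast
    then have ex: "\<exists>q. step A p q" if "p \<in> P" for p
      using \<S>(3) that by simp
    have "\<exists>p. \<forall>k. (p k \<in> P \<and> (k = 0 \<longrightarrow> p k = ({}, []))) \<and> step A (p k) (p (Suc k))"
    proof (rule dependent_nat_choice)
      show "\<exists>p. p \<in> P \<and> (0 = (0::nat) \<longrightarrow> p = ({}, []))"
        using large_Nil by (auto simp: P_def)
    next
      fix p and k :: nat
      assume "p \<in> P \<and> (k = 0 \<longrightarrow> p = ({}, []))"
      then show "\<exists>q. (q \<in> P \<and> (Suc k = 0 \<longrightarrow> q = ({}, []))) \<and> step A p q"
        using ex[of p] by (auto simp: P_def step_def)
    qed
    then show False using no_infinite_run[OF that] by blast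
  qed
  then show ?thesis
    using cP \<S>(1,2) by (intro exI[of _ "\<Union>p\<in>P. \<S> p"]) auto
qed

end

section \<open>From omitting families to a reduction to \<open>nwd\<close>\<close>

lemma nwdI:
  assumes "B \<subseteq> \<rat>"
    and "\<And>U. open U \<Longrightarrow> U \<noteq> {} \<Longrightarrow> \<exists>V. open V \<and> V \<noteq> {} \<and> V \<subseteq> U \<and> V \<inter> B = {}"
  shows "B \<in> nwd"
proof -
  have False if "x \<in> (top_of_set \<rat>) interior_of ((top_of_set \<rat>) closure_of B)" for x
  proof -
    from that obtain T where "openin (top_of_set \<rat>) T" "x \<in> T"
      and T: "T \<subseteq> (top_of_set \<rat>) closure_of B"
      unfolding interior_of_def by blast
    then obtain U where U: "open U" "T = \<rat> \<inter> U"
      by (auto simp: openin_open)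
    then have "U \<noteq> {}" using \<open>x \<in> T\<close> by blast
    then obtain V where V: "open V" "V \<noteq> {}" "V \<subseteq> U" "V \<inter> B = {}"
      using assms(2) U(1) by blast
    from V(1,2) obtain v \<epsilon> where "\<epsilon> > 0" "ball v \<epsilon> \<subseteq> V"
      by (meson all_not_in_conv openE)
    moreover obtain q where "q \<in> \<rat>" "v < q" "q < v + \<epsilon>"
      using Rats_dense_in_real[of v "v + \<epsilon>"] \<open>\<epsilon> > 0\<close> by auto
    ultimately have q: "q \<in> \<rat>" "q \<in> V"
      by (auto simp: dist_real_def subset_iff)
    have "q \<in> (top_of_set \<rat>) closure_of B" using q V(3) T U(2) by blast
    moreover have "openin (top_of_set \<rat>) (\<rat> \<inter> V)" using V(1) by (auto simp: openin_open)
    ultimately show False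
      using q V(4) unfolding in_closure_of by blast
  qed
  then show ?thesis using assms(1) unfolding nwd_def by blast
qed

text \<open>A rational \<open>q\<close> descends through the dyadic intervals containing it; a bit 1 at level \<open>k\<close> passes
  from the current set to the member of its family indexed by \<open>fst (prod_decode k)\<close>, a bit 0 keeps
  the current set. Every index occurs at arbitrarily late levels.\<close>

fun dyadic_set :: "('a set \<Rightarrow> nat \<Rightarrow> 'a set) \<Rightarrow> nat \<Rightarrow> int \<Rightarrow> 'a set" where
  "dyadic_set e 0 i = UNIV"
| "dyadic_set e (Suc k) i = (let S = dyadic_set e k (i div 2) in
     if even i then S else e S (fst (prod_decode k)))"

text \<open>Zero bits allow waiting for a level at which the desired index is on offer.\<close>

lemma dyadic_set_zeros: "dyadic_set e (k + l) (i * 2 ^ l) = dyadic_set e k i"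
proof (induction l)
  case (Suc l)
  have "i * 2 ^ Suc l = 2 * (i * 2 ^ l)" by simp
  then show ?case using Suc by (simp only: add_Suc_right dyadic_set.simps Let_def) simp
qed simp

lemma dyadic_set_notin:
  assumes "UNIV \<notin> I" "\<And>S n. S \<notin> I \<Longrightarrow> e S n \<notin> I"
  shows "dyadic_set e k i \<notin> I"
  using assms by (induction k arbitrary: i) (auto simp: Let_def)

lemma dyadic_set_mono:
  assumes "UNIV \<notin> I" "\<And>S n. S \<notin> I \<Longrightarrow> e S n \<notin> I \<and> e S n \<subseteq> S"
  shows "dyadic_set e (k + l) i \<subseteq> dyadic_set e k (i div 2 ^ l)"
proof (induction l arbitrary: i)
  case (Suc l)
  have "dyadic_set e (k + Suc l) i \<subseteq> dyadic_set e (k + l) (i div 2)"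
    using assms(2) dyadic_set_notin[of I e "k + l" "i div 2"] assms by (auto simp: Let_def)
  also have "\<dots> \<subseteq> dyadic_set e k (i div 2 div 2 ^ l)" by (rule Suc)
  also have "i div 2 div 2 ^ l = i div 2 ^ Suc l"
    by (simp add: zdiv_zmult2_eq)
  finally show ?case .
qed simp

text \<open>The rational with number \<open>N q\<close> is sent into the set attached to its dyadic
  interval of level \<open>N q\<close>. Sets shrink along the tree, so at level \<open>K\<close> all
  but finitely many rationals of an interval go into its set. Below any interval lies one whose set
  is disjoint from a given member of \<open>I\<close>.\<close>

lemma katetov_le_nwd_if_omitting:
  fixes I :: "nat set set"
  assumes UNIV: "UNIV \<notin> I" and empty: "{} \<in> I"
    and fam: "\<And>X. X \<notin> I \<Longrightarrow> \<exists>\<S>. countable \<S> \<and> (\<forall>S\<in>\<S>. S \<subseteq> X \<and> S \<notin> I) \<and> (\<forall>A\<in>I. \<exists>S\<in>\<S>. S \<inter> A = {})"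
  shows "katetov_le I UNIV nwd \<rat>"
proof -
  have "\<exists>e :: nat \<Rightarrow> nat set. X \<notin> I \<longrightarrow> (\<forall>n. e n \<subseteq> X \<and> e n \<notin> I) \<and> (\<forall>A\<in>I. \<exists>n. e n \<inter> A = {})" for X
  proof (cases "X \<in> I")
    case False
    then obtain \<S> where \<S>: "countable \<S>" "\<forall>S\<in>\<S>. S \<subseteq> X \<and> S \<notin> I" "\<forall>A\<in>I. \<exists>S\<in>\<S>. S \<inter> A = {}"
      using fam[OF False] by blast
    then have "\<S> \<noteq> {}" using empty by blast
    then have "range (from_nat_into \<S>) = \<S>" using \<S>(1) by (rule range_from_nat_into)
    then show ?thesis using \<S>(2,3)
      by (intro exI[of _ "from_nat_into \<S>"]) (metis rangeE rangeI)
  qed simp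
  then obtain e :: "nat set \<Rightarrow> nat \<Rightarrow> nat set" where
    e: "\<And>X n. X \<notin> I \<Longrightarrow> e X n \<notin> I \<and> e X n \<subseteq> X"
    and omit: "\<And>X A. X \<notin> I \<Longrightarrow> A \<in> I \<Longrightarrow> \<exists>n. e X n \<inter> A = {}"
    by metis
  define T where "T = dyadic_set e"
  have T_notin: "T k i \<notin> I" for k i
    unfolding T_def using UNIV e by (intro dyadic_set_notin) auto
  define N where "N = to_nat_on (\<rat> :: real set)"
  define h where "h q = (SOME x. x \<in> T (N q) \<lfloor>2 ^ N q * q\<rfloor>)" for q :: real
  have h: "h q \<in> T (N q) \<lfloor>2 ^ N q * q\<rfloor>" for q
    unfolding h_def by (rule someI_ex) (use T_notin empty in \<open>metis all_not_in_conv\<close>)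
  have h_mem: "h q \<in> T K \<lfloor>2 ^ K * q\<rfloor>" if "K \<le> N q" for q K
  proof -
    define l where "l = N q - K"
    have N: "N q = K + l" using that by (simp add: l_def)
    have "\<lfloor>2 ^ N q * q\<rfloor> div 2 ^ l = \<lfloor>2 ^ N q * q / 2 ^ l\<rfloor>"
      using floor_divide_real_eq_div[of "2 ^ l" "2 ^ N q * q"] by simp
    also have "2 ^ N q * q / 2 ^ l = 2 ^ K * q"
      by (simp add: N power_add)
    finally have "\<lfloor>2 ^ N q * q\<rfloor> div 2 ^ l = \<lfloor>2 ^ K * q\<rfloor>" .
    moreover have "T (N q) \<lfloor>2 ^ N q * q\<rfloor> \<subseteq> T K (\<lfloor>2 ^ N q * q\<rfloor> div 2 ^ l)"
      unfolding T_def N by (rule dyadic_set_mono[of I, OF UNIV e])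
    ultimately show ?thesis using h[of q] by auto
  qed
  have "{q\<in>\<rat>. h q \<in> A} \<in> nwd" if A: "A \<in> I" for A
  proof (rule nwdI)
    fix U :: "real set" assume U: "open U" "U \<noteq> {}"
    then obtain x \<epsilon> where x: "\<epsilon> > 0" "ball x \<epsilon> \<subseteq> U"
      by (meson all_not_in_conv openE)
    obtain k where k: "(1/2) ^ k < \<epsilon>"
      using real_arch_pow_inv[of \<epsilon> "1/2"] x(1) by auto
    define i where "i = \<lfloor>2 ^ k * x\<rfloor>"
    obtain n where n: "e (T k i) n \<inter> A = {}"
      using omit[OF T_notin A] by blast
    \<comment> \<open>The passage from level \<open>k + l\<close> to the next one uses index
      \<open>n\<close>; pairing \<open>n\<close> with \<open>k\<close> guarantees a level not below
      \<open>k\<close>. Then \<open>j\<close> is \<open>i\<close> followed by \<open>l\<close> zero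
      bits and a bit 1.\<close>
    define l where "l = prod_encode (n, k) - k"
    have kl: "k + l = prod_encode (n, k)"
      unfolding l_def using le_prod_encode_2[of k n] by simp
    define K where "K = Suc (k + l)"
    define j where "j = 2 * (i * 2 ^ l) + 1"
    have Tj: "T K j = e (T k i) n"
      using dyadic_set_zeros[of e k l i] kl by (simp add: T_def K_def j_def Let_def)
    \<comment> \<open>Rationals numbered below \<open>K\<close> are removed: their values were
      chosen before level \<open>K\<close> and may lie outside \<open>T K j\<close>.\<close>
    define V where "V = {j / 2 ^ K <..< (j + 1) / 2 ^ K} - {q\<in>\<rat>. N q < K}"
    have "finite {q\<in>\<rat>. N q < K}"
      by (rule finite_subset[OF _ finite_vimage_IntI[of "{..<K}" N \<rat>]])
        (auto simp: N_def countable_rat inj_on_to_nat_on)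
    then have "open V" and "V \<noteq> {}"
    proof -
      assume fin: "finite {q\<in>\<rat>. N q < K}"
      show "open V" unfolding V_def using fin by (intro open_Diff finite_imp_closed) auto
      have "infinite {j / 2 ^ K <..< (j + 1) / (2 ^ K :: real)}"
        by (simp add: infinite_Ioo divide_strict_right_mono)
      then show "V \<noteq> {}" unfolding V_def using fin
        by (metis Diff_eq_empty_iff finite_subset)
    qed
    moreover have "V \<subseteq> U"
    proof
      fix q assume "q \<in> V"
      then have q: "j < 2 ^ K * q" "2 ^ K * q < j + 1"
        by (auto simp: V_def field_simps)
      \<comment> \<open>The ratio of interval lengths between levels \<open>k\<close> and
        \<open>K\<close>; as it is at least 2, interval \<open>j\<close> lies inside interval
        \<open>i\<close>.\<close>
      define c :: real where "c = 2 * 2 ^ l"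
      have c: "2 \<le> c" by (simp add: c_def)
      have pow: "2 ^ K = c * 2 ^ k" and j: "real_of_int j = c * i + 1"
        by (simp_all add: K_def j_def c_def power_add)
      have "c * i + 1 < c * (2 ^ k * q)" "c * (2 ^ k * q) < c * i + 2"
        using q by (simp_all add: pow j mult.assoc)
      then have "c * i < c * (2 ^ k * q)" "c * (2 ^ k * q) < c * (i + 1)"
        using c unfolding of_int_add of_int_1 distrib_left by linarith+
      then have "i < 2 ^ k * q" "2 ^ k * q < i + 1"
        using c by (simp_all add: mult_less_cancel_left_pos)
      moreover have "i \<le> 2 ^ k * x" "2 ^ k * x < i + 1"
        unfolding i_def by linarith+
      ultimately have "\<bar>2 ^ k * (q - x)\<bar> < 1"
        by (simp add: algebra_simps abs_less_iff)
      then have "2 ^ k * \<bar>q - x\<bar> < 1"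
        by (simp only: abs_mult) simp
      then have "\<bar>q - x\<bar> < (1/2) ^ k"
        by (simp add: power_divide field_simps)
      then show "q \<in> U" using k x(2) by (auto simp: dist_real_def)
    qed
    moreover have "V \<inter> {q\<in>\<rat>. h q \<in> A} = {}"
    proof -
      have "h q \<notin> A" if "q \<in> V" "q \<in> \<rat>" for q
      proof -
        have "\<lfloor>2 ^ K * q\<rfloor> = j"
          using that by (auto simp: V_def field_simps floor_eq_iff)
        moreover have "K \<le> N q" using that by (auto simp: V_def)
        ultimately show ?thesis using h_mem[of K q] Tj n by auto
      qed
      then show ?thesis by blast
    qed
    ultimately show "\<exists>V. open V \<and> V \<noteq> {} \<and> V \<subseteq> U \<and> V \<inter> {q\<in>\<rat>. h q \<in> A} = {}" by blast
  qed auto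
  then show ?thesis
    unfolding katetov_le_def by (intro exI[of _ h]) auto
qed

section \<open>Continuity in terms of digits, and the dichotomy\<close>

lemma continuous_map_baire_cantor_local:
  assumes "continuous_map baire_space cantor_space f"
  shows "\<exists>k. \<forall>y'. (\<forall>i<k. y' i = y i) \<longrightarrow> f y' n = f y n"
proof -
  have "continuous_map baire_space (discrete_topology UNIV) (\<lambda>y. f y n)"
    using assms unfolding cantor_space_def by (auto simp: continuous_map_componentwise)
  then have "openin baire_space {y' \<in> topspace baire_space. f y' n \<in> {f y n}}"
    by (rule openin_continuous_map_preimage) simp
  then have "openin (product_topology (\<lambda>_. discrete_topology UNIV) UNIV) {y'. f y' n = f y n}"
    by (simp add: baire_space_def)
  then have "\<exists>U. finite {i. U i \<noteq> UNIV} \<and> y \<in> Pi\<^sub>E UNIV U \<and> Pi\<^sub>E UNIV U \<subseteq> {y'. f y' n = f y n}"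
    unfolding openin_product_topology_alt by simp
  then obtain U where U: "finite {i. U i \<noteq> UNIV}" "y \<in> Pi\<^sub>E UNIV U"
    "Pi\<^sub>E UNIV U \<subseteq> {y'. f y' n = f y n}"
    by blast
  obtain k where "\<forall>i\<in>{i. U i \<noteq> UNIV}. i < k"
    using U(1) finite_nat_set_iff_bounded by blast
  then have "y' \<in> Pi\<^sub>E UNIV U" if "\<forall>i<k. y' i = y i" for y'
  proof -
    have "y' i \<in> U i" for i
      using \<open>\<forall>i\<in>{i. U i \<noteq> UNIV}. i < k\<close> that U(2)
      by (cases "U i = UNIV") (auto simp: PiE_iff)
    then show ?thesis by (simp add: PiE_iff)
  qed
  then have "f y' n = f y n" if "\<forall>i<k. y' i = y i" for y'
    using that subsetD[OF U(3), of y'] by simp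
  then show ?thesis by (intro exI[of _ k] allI impI)
qed

theorem theorem50:
  fixes I :: "nat set set"
  assumes "ideal_on I UNIV" and "coanalytic I"
  shows "category_dichotomy I"
proof (cases "\<exists>n. {n} \<notin> I")
  \<comment> \<open>A point with positive singleton lies in no member of \<open>I\<close>, so the
    constant map at it has only empty preimages.\<close>
  case True
  then obtain n where "{n} \<notin> I" by blast
  then have "n \<notin> A" if "A \<in> I" for A
    using that assms(1) unfolding ideal_on_def by blast
  then have "{x\<in>\<rat>. n \<in> A} \<in> nwd" if "A \<in> I" for A
    using that by (simp add: nwd_def)
  then have "katetov_le I UNIV nwd \<rat>"
    unfolding katetov_le_def by (intro exI[of _ "\<lambda>_. n"]) simp
  then show ?thesis by (simp add: category_dichotomy_def)
next
  case False
  interpret nat_ideal I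
  proof
    show "A \<in> I" if "finite A" for A
      using that
    proof (induction A rule: finite_induct)
      case empty
      then show ?case using assms(1) by (simp add: ideal_on_def)
    next
      case (insert x A)
      then have "{x} \<union> A \<in> I"
        using assms(1) False unfolding ideal_on_def by blast
      then show ?case by simp
    qed
  qed (rule assms(1))
  show ?thesis
  proof (cases "\<exists>X. X \<notin> I \<and> katetov_le ED UNIV (I \<inter> Pow X) X")
    case True
    then show ?thesis by (simp add: category_dichotomy_def)
  next
    case False
    then have sel: "selective I" by (intro selective_if_not_ED_le) blast
    let ?chi = "\<lambda>A n. n \<in> (A :: nat set)"
    have "inj ?chi" by (auto simp: inj_def fun_eq_iff)
    then have chi: "?chi A \<in> ?chi ` I \<longleftrightarrow> A \<in> I" for A
      by (rule inj_image_mem_iff)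
    \<comment> \<open>This discards the empty alternative in \<open>analytic_set\<close>, so a
      parametrization exists.\<close>
    have "- ?chi ` I \<noteq> {}" using chi[of UNIV] UNIV_notin by blast
    then obtain g where g: "continuous_map baire_space cantor_space g" "range g = - ?chi ` I"
      using assms(2) unfolding coanalytic_def coanalytic_set_def analytic_set_def by blast
    define f where "f y = Collect (g y)" for y
    have f_range: "range f = - I"
    proof (rule set_eqI)
      fix A
      have "A = Collect P \<longleftrightarrow> ?chi A = P" for P by auto
      then have "A \<in> range f \<longleftrightarrow> ?chi A \<in> range g"
        unfolding f_def image_iff by simp
      also have "\<dots> \<longleftrightarrow> A \<in> - I" unfolding g(2) by (simp add: chi)
      finally show "A \<in> range f \<longleftrightarrow> A \<in> - I" .
    qed
    have "katetov_le I UNIV nwd \<rat>"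
    proof (rule katetov_le_nwd_if_omitting[OF UNIV_notin])
      fix X assume X: "X \<notin> I"
      interpret selective_coanalytic I f X
      proof
        show "\<exists>k. \<forall>y'. (\<forall>i<k. y' i = y i) \<longrightarrow> (n \<in> f y' \<longleftrightarrow> n \<in> f y)" for y n
          using continuous_map_baire_cantor_local[OF g(1), of y n] by (simp add: f_def)
      qed (fact f_range sel X)+
      show "\<exists>\<S>. countable \<S> \<and> (\<forall>S\<in>\<S>. S \<subseteq> X \<and> S \<notin> I) \<and> (\<forall>A\<in>I. \<exists>S\<in>\<S>. S \<inter> A = {})"
        by (rule countable_omitting_family)
    qed (simp add: finite_mem)
    then show ?thesis by (simp add: category_dichotomy_def)
  qed
qed

end
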